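(* Let $M_0\subset\mathbb{C}^3$ be a holomorphically nondegenerate model hypersurface given by one single symmetric $Y$-chain, that is, $M_0$ is given by $$\operatorname{Im} w=\sum_{j=1}^N U^j\,\overline{U^{N-j+1}},$$ where $Y\in\mathfrak{g}_c$ is nonzero and $\{U^1,\dots,U^N\}$ is a symmetric $Y$-chain. Then $M_0$ is not pseudoconvex.
   Context: Coordinates on $\mathbb{C}^3$ are $(z,w)$ with $z=(z_1,z_2)$. A model hypersurface is $M_0=\{\operatorname{Im} w=Q(z,\bar z)\}$, where $Q$ is a nonzero real-valued polynomial in $(z,\bar z)$, homogeneous of degree $m$, without pluriharmonic terms (no monomials depending only on $z$ or only on $\bar z$). Here $Q=\sum_{j=1}^N U^j\overline{U^{N-j+1}}$. $\mathfrak{g}_c=\bigoplus_{\tau=1}^{m-2}\mathfrak{g}_{\tau/m}$, where $\mathfrak{g}_{\tau/m}$ is the space of vector fields $\sum_{j} f^j(z)\partial_{z_j}$ with $f^j$ holomorphic homogeneous polynomials in $z$ of degree $\tau+1$ satisfying $\sum_j(f^jQ_{z_j}+\overline{f^j}Q_{\bar z_j})=0$. The vector field $Y$ is assumed homogeneous, i.e. it belongs to one of the $\mathfrak{g}_{\tau/m}$, $1\le\tau\le m-2$. A symmetric $Y$-chain is a finite sequence $\{U^1,\dots,U^N\}$ of holomorphic homogeneous polynomials in $z$ such that $Y(U^N)=0$ and $Y(U^j)=c_jU^{j+1}$ for $j=1,\dots,N-1$, where the $c_j$ are nonzero complex constants satisfying $c_j=-\overline{c_{N-j}}$. $M_0$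 is holomorphically nondegenerate (at $0$) if there is no nonzero germ at $0$ of a holomorphic vector field (with holomorphic coefficients, type $(1,0)$) on $\mathbb{C}^3$ tangent to $M_0$. $M_0$ is pseudoconvex if its Levi form is semidefinite of a constant sign, i.e. $Q$ (or $-Q$) is plurisubharmonic. *)

theory Defs
  imports "HOL-Analysis.Analysis"
begin

text \<open>Multi-indices are vectors \<open>\<alpha> :: nat ^ 'n\<close> of exponents.\<close>

definition mdeg :: "nat ^ 'n \<Rightarrow> nat" where
  "mdeg \<alpha> = (\<Sum>i\<in>UNIV. \<alpha> $ i)"

definition monomial :: "nat ^ 'n \<Rightarrow> complex ^ 'n \<Rightarrow> complex" where
  "monomial \<alpha> z = (\<Prod>i\<in>UNIV. (z $ i) ^ (\<alpha> $ i))"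

definition hom_hol_poly :: "nat \<Rightarrow> (complex ^ 'n \<Rightarrow> complex) \<Rightarrow> bool" where
  "hom_hol_poly d f \<longleftrightarrow>
     (\<exists>a. \<forall>z. f z = (\<Sum>\<alpha> | mdeg \<alpha> = d. a \<alpha> * monomial \<alpha> z))"

definition model_polynomial :: "nat \<Rightarrow> (complex ^ 'n \<Rightarrow> real) \<Rightarrow> bool" where
  "model_polynomial m Q \<longleftrightarrow>
     (\<exists>z. Q z \<noteq> 0) \<and>
     (\<exists>a. (\<forall>z. complex_of_real (Q z) =
                (\<Sum>(\<alpha>, \<beta>) | mdeg \<alpha> + mdeg \<beta> = m. a \<alpha> \<beta> * monomial \<alpha> z * cnj (monomial \<beta> z))) \<and>
          (\<forall>\<alpha>. a \<alpha> 0 = 0) \<and> (\<forall>\<beta>. a 0 \<beta> = 0))"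

text \<open>The two sums above range over finite sets, so they are not zero by convention.\<close>

lemma finite_mdeg_le: "finite {\<alpha> :: nat ^ 'n. mdeg \<alpha> \<le> m}"
proof -
  have "\<alpha> $ i \<le> m" if "mdeg \<alpha> \<le> m" for \<alpha> :: "nat ^ 'n" and i
    using that member_le_sum[of i UNIV "\<lambda>i. \<alpha> $ i"] by (simp add: mdeg_def)
  then have "{\<alpha> :: nat ^ 'n. mdeg \<alpha> \<le> m} \<subseteq> vec_lambda ` (UNIV \<rightarrow>\<^sub>E {..m})"
    by (auto intro!: image_eqI[where x = "vec_nth _"] simp: vec_nth_inverse)
  then show ?thesis
    by (rule finite_subset) (intro finite_imageI finite_PiE; simp)
qed

lemma finite_mdeg_eq: "finite {\<alpha> :: nat ^ 'n. mdeg \<alpha> = d}"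
  by (rule finite_subset[OF _ finite_mdeg_le[of d]]) auto

lemma finite_mdeg_add_eq: "finite {(\<alpha> :: nat ^ 'n, \<beta> :: nat ^ 'n). mdeg \<alpha> + mdeg \<beta> = m}"
  by (rule finite_subset[OF _ finite_cartesian_product[OF finite_mdeg_le[of m] finite_mdeg_le[of m]]])
    auto

text \<open>Wirtinger derivatives \<open>\<partial>/\<partial>z\<^sub>j\<close> and \<open>\<partial>/\<partial>\<bar>z\<^sub>j\<close>, where \<open>axis j 1\<close> and \<open>axis j \<i>\<close> are the real
  directions \<open>x\<^sub>j\<close> and \<open>y\<^sub>j\<close>.\<close>

definition d_z :: "'n \<Rightarrow> (complex ^ 'n \<Rightarrow> complex) \<Rightarrow> complex ^ 'n \<Rightarrow> complex" where
  "d_z j f p = (frechet_derivative f (at p) (axis j 1)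
                - \<i> * frechet_derivative f (at p) (axis j \<i>)) / 2"

definition d_zbar :: "'n \<Rightarrow> (complex ^ 'n \<Rightarrow> complex) \<Rightarrow> complex ^ 'n \<Rightarrow> complex" where
  "d_zbar j f p = (frechet_derivative f (at p) (axis j 1)
                   + \<i> * frechet_derivative f (at p) (axis j \<i>)) / 2"

text \<open>A vector field \<open>\<Sum>\<^sub>j X\<^sup>j \<partial>/\<partial>z\<^sub>j\<close> is represented by its coefficient map \<open>X\<close>.\<close>

definition apply_field ::
  "(complex ^ 'n \<Rightarrow> complex ^ 'n) \<Rightarrow> (complex ^ 'n \<Rightarrow> complex) \<Rightarrow> complex ^ 'n \<Rightarrow> complex" where
  "apply_field X f p = (\<Sum>j\<in>UNIV. X p $ j * d_z j f p)"

text \<open>\<open>g_component Q \<tau>\<close> is \<open>\<gg>\<^bsub>\<tau>/m\<^esub>\<close>.\<close>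

definition g_component :: "(complex ^ 'n \<Rightarrow> real) \<Rightarrow> nat \<Rightarrow> (complex ^ 'n \<Rightarrow> complex ^ 'n) set" where
  "g_component Q \<tau> =
     {Y. (\<forall>j. hom_hol_poly (\<tau> + 1) (\<lambda>z. Y z $ j)) \<and>
         (\<forall>z. (\<Sum>j\<in>UNIV. Y z $ j * d_z j (\<lambda>z. complex_of_real (Q z)) z
                       + cnj (Y z $ j) * d_zbar j (\<lambda>z. complex_of_real (Q z)) z) = 0)}"

text \<open>Only the values \<open>U 1, \<dots>, U N\<close> belong to the chain.\<close>

definition symmetric_chain ::
  "(complex ^ 'n \<Rightarrow> complex ^ 'n) \<Rightarrow> nat \<Rightarrow> (nat \<Rightarrow> complex ^ 'n \<Rightarrow> complex) \<Rightarrow> bool" where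
  "symmetric_chain Y N U \<longleftrightarrow>
     1 \<le> N \<and>
     (\<forall>j\<in>{1..N}. \<exists>d. hom_hol_poly d (U j)) \<and>
     (\<forall>z. apply_field Y (U N) z = 0) \<and>
     (\<exists>c. \<forall>j\<in>{1..<N}. c j \<noteq> 0 \<and> c j = - cnj (c (N - j)) \<and>
            (\<forall>z. apply_field Y (U j) z = c j * U (j + 1) z))"

text \<open>A point of \<open>\<complex>\<^sup>3\<close> is \<open>p = (z, w)\<close> with \<open>z = (p $ 1, p $ 2)\<close> and \<open>w = p $ 3\<close>.\<close>

definition defining_function :: "(complex ^ 2 \<Rightarrow> real) \<Rightarrow> complex ^ 3 \<Rightarrow> complex" where
  "defining_function Q p = complex_of_real (Im (p $ 3) - Q (vector [p $ 1, p $ 2]))"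

definition model_hypersurface :: "(complex ^ 2 \<Rightarrow> real) \<Rightarrow> (complex ^ 3) set" where
  "model_hypersurface Q = {p. Im (p $ 3) = Q (vector [p $ 1, p $ 2])}"

definition holomorphic_field_on ::
  "(complex ^ 'n) set \<Rightarrow> (complex ^ 'n \<Rightarrow> complex ^ 'n) \<Rightarrow> bool" where
  "holomorphic_field_on S X \<longleftrightarrow>
     (\<forall>p\<in>S. \<exists>D. (X has_derivative D) (at p) \<and> (\<forall>c v. D (c *s v) = c *s D v))"

text \<open>Tangency of a field \<open>X\<close> of type \<open>(1,0)\<close> means that \<open>X\<close> itself, and not merely its real
  part, annihilates the defining function along the hypersurface: \<open>Re (\<partial>/\<partial>w)\<close> is always
  tangent to a model hypersurface.\<close>

definition holomorphically_nondegenerate :: "(complex ^ 2 \<Rightarrow> real) \<Rightarrow> bool" where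
  "holomorphically_nondegenerate Q \<longleftrightarrow>
     \<not> (\<exists>X S. open S \<and> 0 \<in> S \<and> holomorphic_field_on S X \<and>
              (\<forall>p \<in> S \<inter> model_hypersurface Q. apply_field X (defining_function Q) p = 0) \<and>
              (\<exists>\<^sub>F p in nhds 0. X p \<noteq> 0))"

text \<open>The sum is real for a smooth real-valued \<open>r\<close>, since the mixed second derivatives form a
  Hermitian matrix; \<open>Re\<close> only changes the type.\<close>

definition levi_form :: "(complex ^ 'n \<Rightarrow> complex) \<Rightarrow> complex ^ 'n \<Rightarrow> complex ^ 'n \<Rightarrow> real" where
  "levi_form r p v =
     Re (\<Sum>j\<in>UNIV. \<Sum>k\<in>UNIV. d_z j (d_zbar k r) p * v $ j * cnj (v $ k))"

definition holomorphic_tangent :: "(complex ^ 'n \<Rightarrow> complex) \<Rightarrow> complex ^ 'n \<Rightarrow> (complex ^ 'n) set" where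
  "holomorphic_tangent r p = {v. (\<Sum>j\<in>UNIV. v $ j * d_z j r p) = 0}"

definition pseudoconvex_model :: "(complex ^ 2 \<Rightarrow> real) \<Rightarrow> bool" where
  "pseudoconvex_model Q \<longleftrightarrow>
     (let r = defining_function Q in
       (\<forall>p \<in> model_hypersurface Q. \<forall>v \<in> holomorphic_tangent r p. levi_form r p v \<ge> 0) \<or>
       (\<forall>p \<in> model_hypersurface Q. \<forall>v \<in> holomorphic_tangent r p. levi_form r p v \<le> 0))"

end

theory Submission
  imports Defs
begin

text \<open>
  Suppose the Levi form of \<open>M\<^sub>0\<close> had a constant sign; a nonzero holomorphic vector field tangent to
  \<open>M\<^sub>0\<close> is then constructed, against holomorphic nondegeneracy. The Levi form at \<open>z\<close> in the direction
  \<open>v\<close> is, up to sign, \<open>L(z, v) = \<Sum>\<^sub>j v(U\<^sup>j) \<cdot> cnj (v(U\<^sup>N\<^sup>-\<^sup>j\<^sup>+\<^sup>1))\<close>, where \<open>v(f)\<close> is the derivative of \<open>f\<close>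
  in the direction \<open>v\<close>.

  Since \<open>Y\<close> raises degrees by \<open>\<tau> > 0\<close>, the polynomial \<open>U\<^sup>j\<close> is homogeneous of degree
  \<open>deg j = d + (j - 1)\<tau>\<close>. Hence, along the circle orbit \<open>(\<mu>z, \<mu>v)\<close> with \<open>\<bar>\<mu>\<bar> = 1\<close>, the \<open>j\<close>-th summand
  of \<open>L\<close> is multiplied by the character \<open>\<mu>\<close> to the power \<open>deg j - deg (N - j + 1) = (2j - N - 1)\<tau>\<close>.
  These exponents are pairwise distinct, and only the middle summand, which exists when \<open>N\<close> is odd,
  has exponent zero. So the mean of \<open>L\<close> over the orbit is \<open>\<bar>v(h)\<bar>\<^sup>2\<close> with \<open>h\<close> the middle member of the
  chain, or zero when \<open>N\<close> is even.

  In two variables there is a nonzero polynomial field \<open>X\<close> with \<open>X(h) = 0\<close>, namely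
  \<open>h\<^bsub>z\<^sub>2\<^esub> \<partial>/\<partial>z\<^sub>1 - h\<^bsub>z\<^sub>1\<^esub> \<partial>/\<partial>z\<^sub>2\<close>, or \<open>\<partial>/\<partial>z\<^sub>1\<close> if \<open>h\<close> is constant. In the direction of \<open>X\<close> the Levi
  form has mean zero over each orbit, and having a constant sign it vanishes there
  (\<open>kills_middle_isotropic\<close>). An isotropic vector of a semidefinite Hermitian form lies in its
  kernel (\<open>isotropic_imp_kernel\<close>), so \<open>\<Sum>\<^sub>j X(U\<^sup>j) \<cdot> cnj (w(U\<^sup>N\<^sup>-\<^sup>j\<^sup>+\<^sup>1)) = 0\<close> for all \<open>w\<close>. Rotating once
  more, and using that the characters are distinct, every summand vanishes
  (\<open>kills_middle_termwise\<close>). With \<open>w\<close> the Euler field \<open>z\<close>, each product \<open>X(U\<^sup>j) \<cdot> cnj (U\<^sup>N\<^sup>-\<^sup>j\<^sup>+\<^sup>1)\<close> is zero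
  (\<open>semidefinite_imp_annihilates\<close>), so that \<open>X(Q) = 0\<close>: the field \<open>X\<close>, extended by zero in the
  \<open>w\<close>-direction, is tangent to \<open>M\<^sub>0\<close>.
\<close>

section \<open>Holomorphic polynomials and their derivatives\<close>

text \<open>An inductive description by ring operations makes closure under substitution and under
  partial differentiation a matter of structural induction, without handling coefficients.\<close>

inductive hol_poly :: "(complex ^ 'n \<Rightarrow> complex) \<Rightarrow> bool" where
  const: "hol_poly (\<lambda>z. c)"
| coord: "hol_poly (\<lambda>z. z $ i)"
| add: "hol_poly f \<Longrightarrow> hol_poly g \<Longrightarrow> hol_poly (\<lambda>z. f z + g z)"
| mult: "hol_poly f \<Longrightarrow> hol_poly g \<Longrightarrow> hol_poly (\<lambda>z. f z * g z)"

lemma hol_poly_uminus: "hol_poly f \<Longrightarrow> hol_poly (\<lambda>z. - f z)"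
  using hol_poly.mult[OF hol_poly.const[of "-1"], of f] by simp

lemma hol_poly_sum:
  "finite A \<Longrightarrow> (\<And>x. x \<in> A \<Longrightarrow> hol_poly (f x)) \<Longrightarrow> hol_poly (\<lambda>z. \<Sum>x\<in>A. f x z)"
  by (induction A rule: finite_induct) (auto intro: hol_poly.intros)

lemma hol_poly_prod:
  "finite A \<Longrightarrow> (\<And>x. x \<in> A \<Longrightarrow> hol_poly (f x)) \<Longrightarrow> hol_poly (\<lambda>z. \<Prod>x\<in>A. f x z)"
  by (induction A rule: finite_induct) (auto intro: hol_poly.intros)

lemma hol_poly_power: "hol_poly f \<Longrightarrow> hol_poly (\<lambda>z. f z ^ n)"
  by (induction n) (auto intro: hol_poly.intros)

lemma hol_poly_monomial: "hol_poly (monomial \<alpha>)"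
  unfolding monomial_def by (intro hol_poly_prod hol_poly_power hol_poly.coord) auto

lemma hom_hol_poly_imp_hol_poly:
  assumes "hom_hol_poly d f"
  shows "hol_poly f"
proof -
  obtain a where "f = (\<lambda>z. \<Sum>\<alpha> | mdeg \<alpha> = d. a \<alpha> * monomial \<alpha> z)"
    using assms by (auto simp: hom_hol_poly_def)
  then show ?thesis
    by (auto intro!: hol_poly_sum hol_poly.mult hol_poly.const hol_poly_monomial finite_mdeg_eq)
qed

lemma hol_poly_comp:
  assumes "hol_poly f" "\<And>i. hol_poly (\<lambda>p. h p $ i)"
  shows "hol_poly (\<lambda>p. f (h p))"
  using assms(1) by induction (auto intro: hol_poly.intros assms(2))

lemma monomial_scale: "monomial \<alpha> (\<mu> *s z) = \<mu> ^ mdeg \<alpha> * monomial \<alpha> z"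
  by (simp add: monomial_def mdeg_def power_mult_distrib prod.distrib power_sum)

lemma hom_hol_poly_scale:
  assumes "hom_hol_poly d f"
  shows "f (\<mu> *s z) = \<mu> ^ d * f z"
proof -
  obtain a where "\<And>z. f z = (\<Sum>\<alpha> | mdeg \<alpha> = d. a \<alpha> * monomial \<alpha> z)"
    using assms by (auto simp: hom_hol_poly_def)
  then show ?thesis
    by (auto simp: monomial_scale sum_distrib_left intro!: sum.cong)
qed

text \<open>For a holomorphic \<open>f\<close> this is the whole differential of \<open>f\<close> at \<open>p\<close>.\<close>

definition dir_z :: "(complex ^ 'n \<Rightarrow> complex) \<Rightarrow> complex ^ 'n \<Rightarrow> complex ^ 'n \<Rightarrow> complex" where
  "dir_z f p v = (\<Sum>j\<in>UNIV. v $ j * d_z j f p)"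

lemma apply_field_eq_dir_z: "apply_field X f p = dir_z f p (X p)"
  by (simp add: apply_field_def dir_z_def)

lemma dir_z_axis [simp]: "dir_z f p (axis k c) = c * d_z k f p"
  by (simp add: dir_z_def axis_def if_distrib [where f = "\<lambda>x. x * _"] cong: if_cong)

lemma dir_z_add: "dir_z f p (u + v) = dir_z f p u + dir_z f p v"
  by (simp add: dir_z_def algebra_simps sum.distrib)

lemma dir_z_scale: "dir_z f p (c *s v) = c * dir_z f p v"
  by (simp add: dir_z_def algebra_simps sum_distrib_left)

text \<open>The differential is complex linear and its coefficients are again polynomials, so the Wirtinger
  derivatives can be iterated as the Levi form requires.\<close>

lemma hol_poly_partials:
  assumes "hol_poly f"
  shows "\<exists>g. (\<forall>k. hol_poly (g k)) \<and>
             (\<forall>p. (f has_derivative (\<lambda>v. \<Sum>k\<in>UNIV. v $ k * g k p)) (at p))"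
  using assms
proof induction
  case (const c)
  show ?case by (rule exI[of _ "\<lambda>_ _. 0"]) (auto intro: hol_poly.const)
next
  case (coord i)
  show ?case
    by (rule exI[of _ "\<lambda>k _. if k = i then 1 else 0"])
       (auto intro: hol_poly.const bounded_linear_imp_has_derivative bounded_linear_vec_nth
         simp: if_distrib cong: if_cong)
next
  case (add f g)
  then obtain f' g' where
    "\<And>k. hol_poly (f' k)" "\<And>p. (f has_derivative (\<lambda>v. \<Sum>k\<in>UNIV. v $ k * f' k p)) (at p)"
    "\<And>k. hol_poly (g' k)" "\<And>p. (g has_derivative (\<lambda>v. \<Sum>k\<in>UNIV. v $ k * g' k p)) (at p)"
    by blast
  then show ?case
    by (intro exI[of _ "\<lambda>k p. f' k p + g' k p"])
       (auto intro!: hol_poly.intros derivative_eq_intros simp: algebra_simps sum.distrib)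
next
  case (mult f g)
  then obtain f' g' where *:
    "\<And>k. hol_poly (f' k)" "\<And>p. (f has_derivative (\<lambda>v. \<Sum>k\<in>UNIV. v $ k * f' k p)) (at p)"
    "\<And>k. hol_poly (g' k)" "\<And>p. (g has_derivative (\<lambda>v. \<Sum>k\<in>UNIV. v $ k * g' k p)) (at p)"
    by blast
  have "((\<lambda>z. f z * g z) has_derivative (\<lambda>v. \<Sum>k\<in>UNIV. v $ k * (f p * g' k p + f' k p * g p))) (at p)"
    for p
    by (rule has_derivative_eq_rhs[OF has_derivative_mult[OF *(2,4)]])
       (auto simp: algebra_simps sum.distrib sum_distrib_left)
  with mult.hyps *(1,3) show ?case
    by (intro exI[of _ "\<lambda>k p. f p * g' k p + f' k p * g p"]) (auto intro!: hol_poly.intros)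
qed

lemma d_z_eq_partial:
  assumes "(f has_derivative (\<lambda>v. \<Sum>k\<in>UNIV. v $ k * g k)) (at p)"
  shows "d_z k f p = g k"
proof -
  have "frechet_derivative f (at p) = (\<lambda>v. \<Sum>k\<in>UNIV. v $ k * g k)"
    using frechet_derivative_at[OF assms] by simp
  then show ?thesis
    by (simp add: d_z_def axis_def if_distrib[where f = "\<lambda>x. x * _"] cong: if_cong)
qed

lemma hol_poly_has_derivative:
  assumes "hol_poly f"
  shows "(f has_derivative dir_z f p) (at p)"
proof -
  obtain g where g: "\<And>p. (f has_derivative (\<lambda>v. \<Sum>k\<in>UNIV. v $ k * g k p)) (at p)"
    using hol_poly_partials[OF assms] by blast
  have "dir_z f p = (\<lambda>v. \<Sum>k\<in>UNIV. v $ k * g k p)"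
    by (simp add: dir_z_def d_z_eq_partial[OF g] fun_eq_iff)
  then show ?thesis using g by simp
qed

lemma hol_poly_d_z:
  assumes "hol_poly f"
  shows "hol_poly (d_z k f)"
proof -
  obtain g where g: "\<And>k. hol_poly (g k)" "\<And>p. (f has_derivative (\<lambda>v. \<Sum>k\<in>UNIV. v $ k * g k p)) (at p)"
    using hol_poly_partials[OF assms] by blast
  have "d_z k f = g k" by (rule ext) (rule d_z_eq_partial[OF g(2)])
  then show ?thesis using g by simp
qed

lemma dir_z_eqI:
  assumes "hol_poly f" "(f has_derivative D) (at p)"
  shows "dir_z f p v = D v"
  using has_derivative_unique[OF hol_poly_has_derivative[OF assms(1)] assms(2)] by simp

lemma dir_z_const [simp]: "dir_z (\<lambda>z. c) p v = 0"
  by (rule dir_z_eqI[OF hol_poly.const]) simp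

text \<open>In a sum of products of a holomorphic and an antiholomorphic factor, each Wirtinger operator
  sees one of the two factors only.\<close>

lemma
  assumes "finite I" "\<And>i. i \<in> I \<Longrightarrow> hol_poly (A i)" "\<And>i. i \<in> I \<Longrightarrow> hol_poly (B i)"
  shows d_z_sesqui: "d_z k (\<lambda>p. \<Sum>i\<in>I. A i p * cnj (B i p)) p = (\<Sum>i\<in>I. d_z k (A i) p * cnj (B i p))"
    and d_zbar_sesqui: "d_zbar k (\<lambda>p. \<Sum>i\<in>I. A i p * cnj (B i p)) p = (\<Sum>i\<in>I. A i p * cnj (d_z k (B i) p))"
proof -
  let ?D = "\<lambda>v. \<Sum>i\<in>I. A i p * cnj (dir_z (B i) p v) + dir_z (A i) p v * cnj (B i p)"
  have "((\<lambda>p. \<Sum>i\<in>I. A i p * cnj (B i p)) has_derivative ?D) (at p)"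
    by (intro has_derivative_sum has_derivative_mult has_derivative_cnj hol_poly_has_derivative assms)
  from frechet_derivative_at[OF this, symmetric]
  have D: "frechet_derivative (\<lambda>p. \<Sum>i\<in>I. A i p * cnj (B i p)) (at p) = ?D" .
  show "d_z k (\<lambda>p. \<Sum>i\<in>I. A i p * cnj (B i p)) p = (\<Sum>i\<in>I. d_z k (A i) p * cnj (B i p))"
    unfolding d_z_def[of k "\<lambda>p. \<Sum>i\<in>I. A i p * cnj (B i p)"] D
    by (simp add: sum_distrib_left sum_subtractf[symmetric] sum.distrib[symmetric] sum_divide_distrib algebra_simps)
  show "d_zbar k (\<lambda>p. \<Sum>i\<in>I. A i p * cnj (B i p)) p = (\<Sum>i\<in>I. A i p * cnj (d_z k (B i) p))"
    unfolding d_zbar_def D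
    by (simp add: sum_distrib_left sum_subtractf[symmetric] sum.distrib[symmetric] sum_divide_distrib algebra_simps)
qed

lemma dir_z_sesqui:
  assumes "finite I" "\<And>i. i \<in> I \<Longrightarrow> hol_poly (A i)" "\<And>i. i \<in> I \<Longrightarrow> hol_poly (B i)"
  shows "dir_z (\<lambda>p. \<Sum>i\<in>I. A i p * cnj (B i p)) p v = (\<Sum>i\<in>I. dir_z (A i) p v * cnj (B i p))"
proof -
  have "dir_z (\<lambda>p. \<Sum>i\<in>I. A i p * cnj (B i p)) p v
        = (\<Sum>j\<in>UNIV. \<Sum>i\<in>I. v $ j * d_z j (A i) p * cnj (B i p))"
    unfolding dir_z_def by (simp add: d_z_sesqui[OF assms] sum_distrib_left mult.assoc)
  also have "\<dots> = (\<Sum>i\<in>I. \<Sum>j\<in>UNIV. v $ j * d_z j (A i) p * cnj (B i p))"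
    by (rule sum.swap)
  finally show ?thesis by (simp add: dir_z_def sum_distrib_right)
qed

lemma levi_form_sesqui:
  assumes "finite I" "\<And>i. i \<in> I \<Longrightarrow> hol_poly (A i)" "\<And>i. i \<in> I \<Longrightarrow> hol_poly (B i)"
  shows "levi_form (\<lambda>p. \<Sum>i\<in>I. A i p * cnj (B i p)) p v
         = Re (\<Sum>i\<in>I. dir_z (A i) p v * cnj (dir_z (B i) p v))"
proof -
  have "d_zbar k (\<lambda>p. \<Sum>i\<in>I. A i p * cnj (B i p)) = (\<lambda>p. \<Sum>i\<in>I. A i p * cnj (d_z k (B i) p))" for k
    by (rule ext) (rule d_zbar_sesqui[OF assms])
  then have "d_z j (d_zbar k (\<lambda>p. \<Sum>i\<in>I. A i p * cnj (B i p))) p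
             = (\<Sum>i\<in>I. d_z j (A i) p * cnj (d_z k (B i) p))" for j k
    by (simp add: d_z_sesqui[OF assms(1,2) hol_poly_d_z[OF assms(3)]])
  then have "levi_form (\<lambda>p. \<Sum>i\<in>I. A i p * cnj (B i p)) p v
    = Re (\<Sum>j\<in>UNIV. \<Sum>k\<in>UNIV. \<Sum>i\<in>I. (v $ j * d_z j (A i) p) * cnj (v $ k * d_z k (B i) p))"
    unfolding levi_form_def
    by (intro arg_cong[of _ _ Re] sum.cong refl) (simp add: sum_distrib_left sum_distrib_right mult_ac)
  also have "\<dots> = Re (\<Sum>i\<in>I. \<Sum>j\<in>UNIV. \<Sum>k\<in>UNIV. (v $ j * d_z j (A i) p) * cnj (v $ k * d_z k (B i) p))"
    by (simp only: sum.swap[of _ I])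
  finally show ?thesis
    by (simp add: dir_z_def sum_product)
qed

text \<open>Multiplying by \<open>\<mu>\<close> on the left avoids the exponent \<open>d - 1\<close>, which would be wrong in the natural
  numbers for \<open>d = 0\<close>.\<close>

lemma dir_z_homogeneous:
  assumes f: "hol_poly f" and hom: "\<And>z. f (\<mu> *s z) = \<mu> ^ d * f z"
  shows "\<mu> * dir_z f (\<mu> *s z) v = \<mu> ^ d * dir_z f z v"
proof -
  have bl: "bounded_linear (\<lambda>z::complex^'n. \<mu> *s z)"
    unfolding linear_conv_bounded_linear[symmetric]
    by (rule linearI) (auto simp: vec_eq_iff algebra_simps)
  have "((\<lambda>z. f (\<mu> *s z)) has_derivative (\<lambda>v. dir_z f (\<mu> *s z) (\<mu> *s v))) (at z)"
    by (rule has_derivative_compose[OF bounded_linear_imp_has_derivative[OF bl]])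
       (rule hol_poly_has_derivative[OF f])
  moreover have "((\<lambda>z. f (\<mu> *s z)) has_derivative (\<lambda>v. \<mu> ^ d * dir_z f z v)) (at z)"
    unfolding hom by (intro has_derivative_mult_right hol_poly_has_derivative f)
  ultimately have "(\<lambda>v. dir_z f (\<mu> *s z) (\<mu> *s v)) = (\<lambda>v. \<mu> ^ d * dir_z f z v)"
    by (rule has_derivative_unique)
  then show ?thesis by (simp add: fun_eq_iff dir_z_scale)
qed

text \<open>Homogeneity away from \<open>\<mu> = 0\<close> suffices here, since it is differentiated at \<open>\<mu> = 1\<close>. That is the
  form in which it is available for the members of a chain.\<close>

lemma euler_identity:
  assumes f: "hol_poly f" and hom: "\<And>\<mu>. \<mu> \<noteq> 0 \<Longrightarrow> f (\<mu> *s z) = \<mu> ^ d * f z"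
  shows "dir_z f z z = of_nat d * f z"
proof -
  have bl: "bounded_linear (\<lambda>\<mu>::complex. \<mu> *s z)"
    unfolding linear_conv_bounded_linear[symmetric]
    by (rule linearI) (auto simp: vec_eq_iff algebra_simps)
  have "((\<lambda>\<mu>. f (\<mu> *s z)) has_derivative (\<lambda>h. dir_z f (1 *s z) (h *s z))) (at 1)"
    by (rule has_derivative_compose[OF bounded_linear_imp_has_derivative[OF bl]])
       (rule hol_poly_has_derivative[OF f])
  then have "((\<lambda>\<mu>. f (\<mu> *s z)) has_field_derivative dir_z f z z) (at 1)"
    unfolding has_field_derivative_def by (rule has_derivative_eq_rhs) (auto simp: dir_z_scale)
  moreover have "((\<lambda>\<mu>. f (\<mu> *s z)) has_field_derivative of_nat d * f z) (at 1)"
  proof (rule has_field_derivative_transform_within_open[where S = "- {0}"])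
    show "((\<lambda>\<mu>. \<mu> ^ d * f z) has_field_derivative of_nat d * f z) (at 1)"
      by (auto intro!: derivative_eq_intros)
  qed (auto simp: hom)
  ultimately show ?thesis by (rule DERIV_unique)
qed

section \<open>Trigonometric sums\<close>

text \<open>Means over the circle are taken over the \<open>M\<close>-th roots of unity, with \<open>M\<close> larger than all
  exponents that occur.\<close>

lemma sum_roots_of_unity_power:
  assumes "0 < n" "n < M"
  shows "(\<Sum>k<M. (cis (2 * pi / M) ^ k) ^ n) = 0"
proof -
  let ?x = "cis (2 * pi / M) ^ n"
  have "?x \<noteq> 1"
  proof
    assume "?x = 1"
    then have "cis (real n * (2 * pi / M)) = 1" by (simp add: Complex.DeMoivre)
    then have "cos (real n * (2 * pi / M)) = 1" by (simp add: complex_eq_iff)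
    then obtain i :: int where "real n * (2 * pi / M) = i * 2 * pi"
      by (auto simp: cos_one_2pi_int)
    then have "real n = i * M" using assms by (simp add: field_simps)
    then have "int n = i * int M" by (metis of_int_eq_iff of_int_mult of_int_of_nat_eq)
    then have "int M dvd int n" by simp
    then show False using assms by (simp add: nat_dvd_not_less)
  qed
  moreover have "?x ^ M = cis (2 * pi * real n)"
    using assms by (simp add: Complex.DeMoivre mult_ac)
  then have "?x ^ M = 1" by simp
  ultimately have "(\<Sum>k<M. ?x ^ k) = 0" by (simp add: geometric_sum)
  then show ?thesis by (simp add: mult.commute flip: power_mult)
qed

lemma unit_power_cnj_power:
  assumes "norm \<mu> = 1" "q \<le> p"
  shows "\<mu> ^ p * cnj \<mu> ^ q = \<mu> ^ (p - q)"
proof -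
  have "\<mu> * cnj \<mu> = 1" using assms(1) by (simp add: complex_norm_square[symmetric])
  moreover have "\<mu> ^ p * cnj \<mu> ^ q = \<mu> ^ (p - q) * (\<mu> * cnj \<mu>) ^ q"
    using assms(2) by (simp add: power_mult_distrib flip: power_add mult.assoc)
  ultimately show ?thesis by simp
qed

lemma mean_zero_character:
  assumes "p \<noteq> q" "p < M" "q < M"
  shows "(\<Sum>k<M. (cis (2 * pi / M) ^ k) ^ p * cnj (cis (2 * pi / M) ^ k) ^ q) = 0"
proof -
  have *: "(\<Sum>k<M. (cis (2 * pi / M) ^ k) ^ p * cnj (cis (2 * pi / M) ^ k) ^ q) = 0"
    if "q < p" "p < M" for p q
  proof -
    have "(cis (2 * pi / M) ^ k) ^ p * cnj (cis (2 * pi / M) ^ k) ^ q = (cis (2 * pi / M) ^ k) ^ (p - q)" for k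
      using that by (intro unit_power_cnj_power) (auto simp: norm_power)
    then show ?thesis
      using sum_roots_of_unity_power[of "p - q" M] that by simp
  qed
  show ?thesis
  proof (cases "q < p")
    case True then show ?thesis using * assms by blast
  next
    case False
    then have "cnj (\<Sum>k<M. (cis (2 * pi / M) ^ k) ^ q * cnj (cis (2 * pi / M) ^ k) ^ p) = cnj 0"
      using * assms by (intro arg_cong[of _ _ cnj]) auto
    then show ?thesis by (simp add: mult.commute)
  qed
qed

text \<open>A sum without constant term has mean zero over the roots of unity; if its real part has a
  constant sign, it must vanish at each of them, in particular at \<open>\<mu> = 1\<close>.\<close>

lemma nonneg_trig_sum_zero_mean:
  fixes a :: "'i \<Rightarrow> complex" and \<epsilon> :: real
  assumes "finite I" and zero: "\<And>i. i \<in> I \<Longrightarrow> p i = q i \<Longrightarrow> a i = 0"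
    and nonneg: "\<And>\<mu>. norm \<mu> = 1 \<Longrightarrow> 0 \<le> \<epsilon> * Re (\<Sum>i\<in>I. \<mu> ^ p i * cnj \<mu> ^ q i * a i)"
  shows "\<epsilon> * Re (\<Sum>i\<in>I. a i) = 0"
proof -
  define M where "M = Suc (\<Sum>i\<in>I. p i + q i)"
  have le: "p i + q i \<le> (\<Sum>i\<in>I. p i + q i)" if "i \<in> I" for i
    using \<open>finite I\<close> that by (intro member_le_sum) auto
  have M: "p i < M" "q i < M" if "i \<in> I" for i
    using le[OF that] by (auto simp: M_def)
  define F where "F \<mu> = (\<Sum>i\<in>I. \<mu> ^ p i * cnj \<mu> ^ q i * a i)" for \<mu>
  define \<omega> where "\<omega> = cis (2 * pi / M)"
  have "(\<Sum>k<M. F (\<omega> ^ k)) = (\<Sum>i\<in>I. (\<Sum>k<M. (\<omega> ^ k) ^ p i * cnj (\<omega> ^ k) ^ q i) * a i)"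
    unfolding F_def by (subst sum.swap) (simp add: sum_distrib_right)
  also have "\<dots> = 0"
  proof (intro sum.neutral ballI)
    fix i assume "i \<in> I"
    show "(\<Sum>k<M. (\<omega> ^ k) ^ p i * cnj (\<omega> ^ k) ^ q i) * a i = 0"
    proof (cases "p i = q i")
      case False
      show ?thesis
        unfolding \<omega>_def mean_zero_character[OF False M[OF \<open>i \<in> I\<close>]] by simp
    qed (simp add: zero \<open>i \<in> I\<close>)
  qed
  finally have "(\<Sum>k<M. \<epsilon> * Re (F (\<omega> ^ k))) = 0"
    by (simp flip: sum_distrib_left Re_sum)
  moreover have "0 \<le> \<epsilon> * Re (F (\<omega> ^ k))" for k
    unfolding F_def by (rule nonneg) (simp add: \<omega>_def norm_power)
  ultimately have "\<forall>k\<in>{..<M}. \<epsilon> * Re (F (\<omega> ^ k)) = 0"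
    by (subst (asm) sum_nonneg_eq_0_iff) auto
  moreover have "0 \<in> {..<M}" by (simp add: M_def)
  ultimately have "\<epsilon> * Re (F (\<omega> ^ 0)) = 0" by blast
  then show ?thesis by (simp add: F_def)
qed

text \<open>Linear independence of distinct characters of the circle: a power of \<open>\<mu>\<close> turns the sum into a
  polynomial with infinitely many zeros.\<close>

lemma trig_sum_coeffs_zero:
  fixes a :: "'i \<Rightarrow> complex" and p q :: "'i \<Rightarrow> nat"
  assumes "finite I" and inj: "inj_on (\<lambda>i. int (p i) - int (q i)) I"
    and zero: "\<And>\<mu>. norm \<mu> = 1 \<Longrightarrow> (\<Sum>i\<in>I. \<mu> ^ p i * cnj \<mu> ^ q i * a i) = 0"
    and "i \<in> I"
  shows "a i = 0"
proof -
  define M where "M = (\<Sum>i\<in>I. q i)"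
  have M: "q i \<le> M" if "i \<in> I" for i
    unfolding M_def using \<open>finite I\<close> that by (intro member_le_sum) auto
  define P where "P = (\<Sum>i\<in>I. monom (a i) (p i + M - q i))"
  have "poly P \<mu> = 0" if "norm \<mu> = 1" for \<mu>
  proof -
    have "\<mu> ^ M * (\<mu> ^ p i * cnj \<mu> ^ q i * a i) = a i * \<mu> ^ (p i + M - q i)" if "i \<in> I" for i
      using unit_power_cnj_power[OF \<open>norm \<mu> = 1\<close>, of "q i" "p i + M"] M[OF that]
      by (simp add: power_add mult_ac)
    then have "poly P \<mu> = (\<Sum>i\<in>I. \<mu> ^ M * (\<mu> ^ p i * cnj \<mu> ^ q i * a i))"
      unfolding P_def poly_sum poly_monom by (intro sum.cong) (simp_all only:)
    also have "\<dots> = 0" using zero[OF \<open>norm \<mu> = 1\<close>] by (simp flip: sum_distrib_left)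
    finally show ?thesis .
  qed
  then have "sphere 0 1 \<subseteq> {\<mu>. poly P \<mu> = 0}" by (auto simp: dist_norm)
  moreover have "infinite (sphere (0::complex) 1)"
  proof
    assume "finite (sphere (0::complex) 1)"
    then consider "sphere (0::complex) 1 = {}" | x where "sphere (0::complex) 1 = {x}"
      using connected_finite_iff_sing[OF connected_sphere[of "0::complex" 1]] by auto
    moreover have "1 \<in> sphere (0::complex) 1" "-1 \<in> sphere (0::complex) 1" by auto
    ultimately show False by (metis empty_iff one_neq_neg_one singletonD)
  qed
  ultimately have "P = 0" using poly_roots_finite finite_subset by metis
  then have "0 = coeff P (p i + M - q i)" by simp
  also have "\<dots> = (\<Sum>j\<in>I. if j = i then a j else 0)"
    unfolding P_def coeff_sum coeff_monom
  proof (rule sum.cong[OF refl])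
    fix j assume "j \<in> I"
    then have "p j + M - q j = p i + M - q i \<longleftrightarrow> j = i"
      using M[of i] M[of j] \<open>i \<in> I\<close> inj_onD[OF inj, of j i] by auto
    then show "(if p j + M - q j = p i + M - q i then a j else 0) = (if j = i then a j else 0)" by simp
  qed
  also have "\<dots> = a i" using assms by simp
  finally show ?thesis by simp
qed

section \<open>The Levi form of a graded chain\<close>

text \<open>The polarized complex Hessian of \<open>Q = \<Sum>\<^sub>j U\<^sup>j \<cdot> cnj (U\<^sup>N\<^sup>-\<^sup>j\<^sup>+\<^sup>1)\<close> at \<open>z\<close>.\<close>

definition chain_pairing ::
  "nat \<Rightarrow> (nat \<Rightarrow> complex ^ 'n \<Rightarrow> complex) \<Rightarrow> complex ^ 'n \<Rightarrow> complex ^ 'n \<Rightarrow> complex ^ 'n \<Rightarrow> complex"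
where
  "chain_pairing N U z v w = (\<Sum>j=1..N. dir_z (U j) z v * cnj (dir_z (U (N - j + 1)) z w))"

lemma chain_pairing_hermitian: "chain_pairing N U z w v = cnj (chain_pairing N U z v w)"
proof -
  have "chain_pairing N U z w v
        = (\<Sum>j=1..N. dir_z (U (N + 1 - j)) z w * cnj (dir_z (U (N - (N + 1 - j) + 1)) z v))"
    unfolding chain_pairing_def by (subst sum.atLeastAtMost_rev) (simp add: add.commute)
  also have "\<dots> = (\<Sum>j=1..N. cnj (dir_z (U j) z v) * dir_z (U (N - j + 1)) z w)"
    by (rule sum.cong) (auto simp: Suc_diff_le)
  finally show ?thesis by (simp add: chain_pairing_def)
qed

lemma chain_pairing_add: "chain_pairing N U z (u + v) w = chain_pairing N U z u w + chain_pairing N U z v w"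
  by (simp add: chain_pairing_def dir_z_add algebra_simps sum.distrib)

lemma chain_pairing_scale: "chain_pairing N U z (c *s v) w = c * chain_pairing N U z v w"
  by (simp add: chain_pairing_def dir_z_scale sum_distrib_left mult.assoc)

text \<open>If \<open>B(u, w) \<noteq> 0\<close>, then \<open>B(w + c u, w + c u)\<close> depends on \<open>c\<close> in a nonconstant real affine way,
  because its quadratic term \<open>\<bar>c\<bar>\<^sup>2 B(u, u)\<close> is absent; it therefore changes sign. The factor \<open>\<epsilon>\<close>
  treats both signs of semidefiniteness at once.\<close>

lemma isotropic_imp_kernel:
  fixes B :: "complex ^ 'n \<Rightarrow> complex ^ 'n \<Rightarrow> complex" and \<epsilon> :: real
  assumes add: "\<And>u v w. B (u + v) w = B u w + B v w"
    and scale: "\<And>c u w. B (c *s u) w = c * B u w"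
    and herm: "\<And>u v. B v u = cnj (B u v)"
    and nonneg: "\<And>v. 0 \<le> \<epsilon> * Re (B v v)"
    and "\<epsilon> \<noteq> 0" and iso: "Re (B u u) = 0"
  shows "B u w = 0"
proof (rule ccontr)
  assume "B u w \<noteq> 0"
  define b where "b = B u w"
  have add_right: "B x (y + z) = B x y + B x z" for x y z
    unfolding herm[of x "y + z"] herm[of x y] herm[of x z] add by simp
  have scale_right: "B x (c *s y) = cnj c * B x y" for c x y
    unfolding herm[of x "c *s y"] herm[of x y] scale by simp
  have expand: "Re (B (w + c *s u) (w + c *s u)) = Re (B w w) + 2 * Re (c * b)" for c
  proof -
    have "B (w + c *s u) (w + c *s u) = B w w + cnj (c * b) + c * b + c * cnj c * B u u"
      using herm[of u w] by (simp add: add scale add_right scale_right b_def algebra_simps)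
    moreover have "Re (c * cnj c * B u u) = 0"
      by (simp add: complex_mult_cnj iso)
    ultimately show ?thesis by simp
  qed
  \<comment> \<open>For \<open>c = - s \<epsilon> cnj b\<close> the affine term is \<open>- 2 s \<epsilon>\<^sup>2 \<bar>b\<bar>\<^sup>2\<close>; \<open>s\<close> is chosen to make the total \<open>-1\<close>.\<close>
  define s where "s = (\<epsilon> * Re (B w w) + 1) / (2 * \<epsilon>\<^sup>2 * (norm b)\<^sup>2)"
  have "b \<noteq> 0" using \<open>B u w \<noteq> 0\<close> by (simp add: b_def)
  define c where "c = complex_of_real (- s * \<epsilon>) * cnj b"
  have "c * b = complex_of_real (- s * \<epsilon> * (norm b)\<^sup>2)"
    by (simp only: c_def of_real_mult complex_norm_square mult_ac)
  then have "Re (c * b) = - s * \<epsilon> * (norm b)\<^sup>2"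
    by (simp only: Re_complex_of_real)
  then have "Re (B (w + c *s u) (w + c *s u)) = Re (B w w) - 2 * s * \<epsilon> * (norm b)\<^sup>2"
    using expand[of c] by simp
  then have "0 \<le> \<epsilon> * (Re (B w w) - 2 * s * \<epsilon> * (norm b)\<^sup>2)"
    using nonneg[of "w + c *s u"] by simp
  also have "\<dots> = \<epsilon> * Re (B w w) - s * (2 * \<epsilon>\<^sup>2 * (norm b)\<^sup>2)"
    by (simp add: algebra_simps power2_eq_square)
  also have "\<dots> = -1"
    using \<open>b \<noteq> 0\<close> \<open>\<epsilon> \<noteq> 0\<close> by (simp add: s_def)
  finally show False by simp
qed

text \<open>A chain seen through its degrees, which form an arithmetic progression because \<open>Y\<close> raises every
  degree by \<open>\<tau>\<close>.\<close>

locale graded_chain =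
  fixes N d \<tau> :: nat and U :: "nat \<Rightarrow> complex ^ 'n \<Rightarrow> complex"
  assumes tau_pos: "0 < \<tau>"
    and hol_poly_U: "j \<in> {1..N} \<Longrightarrow> hol_poly (U j)"
    and homogeneous_U: "\<lbrakk>j \<in> {1..N}; \<mu> \<noteq> 0\<rbrakk> \<Longrightarrow> U j (\<mu> *s z) = \<mu> ^ (d + (j - 1) * \<tau>) * U j z"
begin

definition deg :: "nat \<Rightarrow> nat" where "deg j = d + (j - 1) * \<tau>"

lemma dir_z_U_rotate:
  assumes "j \<in> {1..N}" "norm \<mu> = 1"
  shows "dir_z (U j) (\<mu> *s z) (\<mu> *s v) = \<mu> ^ deg j * dir_z (U j) z v"
proof -
  have "\<mu> \<noteq> 0" using assms(2) by auto
  have "\<mu> * dir_z (U j) (\<mu> *s z) v = \<mu> ^ deg j * dir_z (U j) z v"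
    unfolding deg_def
    by (intro dir_z_homogeneous hol_poly_U homogeneous_U assms(1) \<open>\<mu> \<noteq> 0\<close>)
  then show ?thesis by (simp add: dir_z_scale)
qed

lemma chain_pairing_rotate:
  assumes "norm \<mu> = 1"
  shows "chain_pairing N U (\<mu> *s z) (\<mu> *s v) (\<mu> *s w)
         = (\<Sum>j=1..N. \<mu> ^ deg j * cnj \<mu> ^ deg (N - j + 1)
              * (dir_z (U j) z v * cnj (dir_z (U (N - j + 1)) z w)))"
  unfolding chain_pairing_def
proof (rule sum.cong[OF refl])
  fix j assume j: "j \<in> {1..N}"
  then have j': "N - j + 1 \<in> {1..N}" by auto
  show "dir_z (U j) (\<mu> *s z) (\<mu> *s v) * cnj (dir_z (U (N - j + 1)) (\<mu> *s z) (\<mu> *s w))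
        = \<mu> ^ deg j * cnj \<mu> ^ deg (N - j + 1)
          * (dir_z (U j) z v * cnj (dir_z (U (N - j + 1)) z w))"
    unfolding dir_z_U_rotate[OF j assms] dir_z_U_rotate[OF j' assms] by simp
qed

text \<open>The gap is injective in \<open>j\<close> and vanishes only for the middle index \<open>2j = N + 1\<close>.\<close>

lemma degree_gap:
  assumes "j \<in> {1..N}"
  shows "int (deg j) - int (deg (N - j + 1)) = (2 * int j - int N - 1) * int \<tau>"
proof -
  have deg: "int (deg i) = int d + (int i - 1) * int \<tau>" if "1 \<le> i" for i
    using that by (simp add: deg_def of_nat_diff)
  have "int (N - j + 1) = int N - int j + 1" using assms by auto
  then show ?thesis
    using assms deg[of j] deg[of "N - j + 1"] by (simp add: algebra_simps)
qed

text \<open>The condition is vacuous when \<open>N\<close> is even.\<close>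

definition kills_middle :: "complex ^ 'n \<Rightarrow> complex ^ 'n \<Rightarrow> bool" where
  "kills_middle z v \<longleftrightarrow> (\<forall>j\<in>{1..N}. N - j + 1 = j \<longrightarrow> dir_z (U j) z v = 0)"

text \<open>On the orbit \<open>(\<mu>z, \<mu>v)\<close> the middle summand is the only one that contributes to the mean of the
  Levi form, and it vanishes by assumption.\<close>

lemma kills_middle_isotropic:
  assumes nonneg: "\<And>z v. 0 \<le> \<epsilon> * Re (chain_pairing N U z v v)" and "kills_middle z v"
  shows "\<epsilon> * Re (chain_pairing N U z v v) = 0"
  unfolding chain_pairing_def
proof (rule nonneg_trig_sum_zero_mean[where p = deg and q = "\<lambda>j. deg (N - j + 1)"])
  fix j assume j: "j \<in> {1..N}" and "deg j = deg (N - j + 1)"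
  then have "(2 * int j - int N - 1) * int \<tau> = 0"
    using degree_gap[OF j] by simp
  then have "N - j + 1 = j" using tau_pos j by auto
  then show "dir_z (U j) z v * cnj (dir_z (U (N - j + 1)) z v) = 0"
    using \<open>kills_middle z v\<close> j by (simp add: kills_middle_def)
next
  fix \<mu> :: complex assume "norm \<mu> = 1"
  then show "0 \<le> \<epsilon> * Re (\<Sum>j=1..N. \<mu> ^ deg j * cnj \<mu> ^ deg (N - j + 1)
                        * (dir_z (U j) z v * cnj (dir_z (U (N - j + 1)) z v)))"
    using nonneg[of "\<mu> *s z" "\<mu> *s v"] by (simp only: chain_pairing_rotate)
qed auto

lemma kills_middle_kernel:
  assumes nonneg: "\<And>z v. 0 \<le> \<epsilon> * Re (chain_pairing N U z v v)" and "\<epsilon> \<noteq> 0" and "kills_middle z v"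
  shows "chain_pairing N U z v w = 0"
proof (rule isotropic_imp_kernel[where \<epsilon> = \<epsilon>])
  show "Re (chain_pairing N U z v v) = 0"
    using kills_middle_isotropic[OF nonneg \<open>kills_middle z v\<close>] \<open>\<epsilon> \<noteq> 0\<close> by simp
  show "chain_pairing N U z x y = cnj (chain_pairing N U z y x)" for x y
    by (rule chain_pairing_hermitian)
qed (fact chain_pairing_add chain_pairing_scale nonneg \<open>\<epsilon> \<noteq> 0\<close>)+

text \<open>The hypothesis on \<open>v\<close> is invariant under rotation, so the vanishing of the pairing holds along
  the whole orbit, where its summands are separated by their characters.\<close>

lemma kills_middle_termwise:
  assumes nonneg: "\<And>z v. 0 \<le> \<epsilon> * Re (chain_pairing N U z v v)" and "\<epsilon> \<noteq> 0"
    and v: "kills_middle z v" and j: "j \<in> {1..N}"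
  shows "dir_z (U j) z v * cnj (dir_z (U (N - j + 1)) z w) = 0"
proof (rule trig_sum_coeffs_zero[OF _ _ _ j, where p = deg and q = "\<lambda>j. deg (N - j + 1)"])
  show "inj_on (\<lambda>j. int (deg j) - int (deg (N - j + 1))) {1..N}"
  proof (rule inj_onI)
    fix i j assume "i \<in> {1..N}" "j \<in> {1..N}"
      and "int (deg i) - int (deg (N - i + 1)) = int (deg j) - int (deg (N - j + 1))"
    then have "(2 * int i - int N - 1) * int \<tau> = (2 * int j - int N - 1) * int \<tau>"
      by (simp only: degree_gap)
    then show "i = j" using tau_pos by simp
  qed
  fix \<mu> :: complex assume \<mu>: "norm \<mu> = 1"
  have "kills_middle (\<mu> *s z) (\<mu> *s v)"
    using v \<mu> by (simp add: kills_middle_def dir_z_U_rotate)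
  from kills_middle_kernel[OF nonneg \<open>\<epsilon> \<noteq> 0\<close> this, of "\<mu> *s w"]
  show "(\<Sum>j=1..N. \<mu> ^ deg j * cnj \<mu> ^ deg (N - j + 1)
            * (dir_z (U j) z v * cnj (dir_z (U (N - j + 1)) z w))) = 0"
    by (simp only: chain_pairing_rotate[OF \<mu>])
qed simp

text \<open>The Euler identity replaces the derivative of \<open>U\<^sup>N\<^sup>-\<^sup>j\<^sup>+\<^sup>1\<close> by \<open>U\<^sup>N\<^sup>-\<^sup>j\<^sup>+\<^sup>1\<close> itself, except when its degree is
  zero. That happens only for \<open>j = N\<close> and \<open>d = 0\<close>, which is the case covered by the last hypothesis.\<close>

lemma semidefinite_imp_annihilates:
  assumes nonneg: "\<And>z v. 0 \<le> \<epsilon> * Re (chain_pairing N U z v v)" and "\<epsilon> \<noteq> 0"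
    and v: "kills_middle z v"
    and const: "d = 0 \<Longrightarrow> dir_z (U N) z v = 0"
  shows "(\<Sum>j=1..N. dir_z (U j) z v * cnj (U (N - j + 1) z)) = 0"
proof (rule sum.neutral, rule ballI)
  fix j assume j: "j \<in> {1..N}"
  then have j': "N - j + 1 \<in> {1..N}" by auto
  have "dir_z (U (N - j + 1)) z z = of_nat (deg (N - j + 1)) * U (N - j + 1) z"
    unfolding deg_def by (rule euler_identity[OF hol_poly_U[OF j'] homogeneous_U[OF j']])
  with kills_middle_termwise[OF nonneg \<open>\<epsilon> \<noteq> 0\<close> v j, of z]
  have "deg (N - j + 1) = 0 \<or> dir_z (U j) z v * cnj (U (N - j + 1) z) = 0"
    by auto
  moreover have "dir_z (U j) z v = 0" if "deg (N - j + 1) = 0"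
  proof -
    have "d = 0" "j = N" using that tau_pos j by (auto simp: deg_def)
    then show ?thesis using const by simp
  qed
  ultimately show "dir_z (U j) z v * cnj (U (N - j + 1) z) = 0" by auto
qed

end

section \<open>Symmetric chains\<close>

text \<open>A member of the chain may vanish identically, and then its degree is not determined. Deducing
  the homogeneity of \<open>U\<^sup>j\<^sup>+\<^sup>1\<close> from that of \<open>Y(U\<^sup>j)\<close>, instead of taking any degree that the definition of a
  chain provides, gives degrees in arithmetic progression in all cases.\<close>

lemma symmetric_chain_graded:
  fixes Y :: "complex ^ 'n \<Rightarrow> complex ^ 'n"
  assumes chain: "symmetric_chain Y N U" and Y: "\<And>j. hom_hol_poly (\<tau> + 1) (\<lambda>z. Y z $ j)"
    and U1: "hom_hol_poly d (U 1)" and "0 < \<tau>"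
  shows "graded_chain N d \<tau> U"
proof -
  obtain c where c: "\<And>j. j \<in> {1..<N} \<Longrightarrow> c j \<noteq> 0"
      "\<And>j z. j \<in> {1..<N} \<Longrightarrow> dir_z (U j) z (Y z) = c j * U (j + 1) z"
    using chain unfolding symmetric_chain_def apply_field_eq_dir_z by blast
  have hol: "hol_poly (U j)" if "j \<in> {1..N}" for j
    using chain that hom_hol_poly_imp_hol_poly unfolding symmetric_chain_def by blast
  have hom: "U j (\<mu> *s z) = \<mu> ^ (d + (j - 1) * \<tau>) * U j z"
    if "1 \<le> j" "j \<le> N" "\<mu> \<noteq> 0" for j \<mu> z
    using that
  proof (induction j arbitrary: z rule: dec_induct)
    case base
    then show ?case by (simp add: hom_hol_poly_scale[OF U1[simplified]])
  next
    case (step j)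
    then have j: "j \<in> {1..<N}" by simp
    let ?D = "d + (j - 1) * \<tau>"
    have "Y (\<mu> *s z) = \<mu> ^ (\<tau> + 1) *s Y z"
      by (simp add: vec_eq_iff hom_hol_poly_scale[OF Y] del: power_Suc)
    then have "c j * U (j + 1) (\<mu> *s z) = \<mu> ^ \<tau> * (\<mu> * dir_z (U j) (\<mu> *s z) (Y z))"
      by (simp only: c(2)[OF j, symmetric] dir_z_scale) simp
    also have "\<mu> * dir_z (U j) (\<mu> *s z) (Y z) = \<mu> ^ ?D * dir_z (U j) z (Y z)"
      using step j by (intro dir_z_homogeneous hol) auto
    also have "\<mu> ^ \<tau> * (\<mu> ^ ?D * dir_z (U j) z (Y z)) = c j * (\<mu> ^ (\<tau> + ?D) * U (j + 1) z)"
      by (simp add: c(2)[OF j] power_add)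
    finally have "U (Suc j) (\<mu> *s z) = \<mu> ^ (\<tau> + ?D) * U (Suc j) z"
      using c(1)[OF j] by simp
    moreover have "\<tau> + ?D = d + (Suc j - 1) * \<tau>"
      using j by (cases j) auto
    ultimately show ?case by (simp only:)
  qed
  show ?thesis
    by unfold_locales (use hol hom \<open>0 < \<tau>\<close> in auto)
qed

text \<open>A polynomial of degree zero is constant, so \<open>Y\<close> kills it and the chain breaks off at once.\<close>

lemma symmetric_chain_constant_start:
  assumes chain: "symmetric_chain Y N U" and U1: "hom_hol_poly 0 (U 1)" and "2 \<le> N"
  shows "U N = (\<lambda>z. 0)"
proof -
  obtain c where c: "\<And>j. j \<in> {1..<N} \<Longrightarrow> c j \<noteq> 0"
      "\<And>j z. j \<in> {1..<N} \<Longrightarrow> dir_z (U j) z (Y z) = c j * U (j + 1) z"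
    using chain unfolding symmetric_chain_def apply_field_eq_dir_z by blast
  have "U 1 z = U 1 0" for z
    using hom_hol_poly_scale[OF U1, of 0 z] by simp
  then have const1: "U 1 = (\<lambda>z. U 1 0)" by (rule ext)
  have step: "U (j + 1) = (\<lambda>z. 0)" if "j \<in> {1..<N}" "U j = (\<lambda>z. k)" for j k
    using c[OF that(1)] that(2) by (auto simp: fun_eq_iff)
  have "U j = (\<lambda>z. 0)" if "2 \<le> j" "j \<le> N" for j
    using that
  proof (induction j rule: dec_induct)
    case base
    then show ?case using step[OF _ const1] \<open>2 \<le> N\<close> by (simp add: numeral_2_eq_2)
  next
    case (step j)
    then show ?case using \<open>\<And>k j. \<lbrakk>j \<in> {1..<N}; U j = (\<lambda>z. k)\<rbrakk> \<Longrightarrow> U (j + 1) = (\<lambda>z. 0)\<close>[of j 0] by simp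
  qed
  then show ?thesis using \<open>2 \<le> N\<close> by simp
qed

section \<open>From the plane to the hypersurface\<close>

definition base_point :: "complex ^ 3 \<Rightarrow> complex ^ 2" where
  "base_point p = vector [p $ 1, p $ 2]"

lemma base_point_vector [simp]: "base_point (vector [z $ 1, z $ 2, w]) = z"
  by (simp add: base_point_def vec_eq_iff forall_2)

lemma hol_poly_base_point:
  assumes "hol_poly f"
  shows "hol_poly (\<lambda>p. f (base_point p))"
proof (rule hol_poly_comp[OF assms])
  fix i :: 2
  have "i = 1 \<or> i = 2" using exhaust_2 by blast
  then show "hol_poly (\<lambda>p. base_point p $ i)"
    by (auto simp: base_point_def intro: hol_poly.coord)
qed

lemma dir_z_base_point:
  assumes "hol_poly f"
  shows "dir_z (\<lambda>p. f (base_point p)) p v = dir_z f (base_point p) (base_point v)"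
proof (rule dir_z_eqI[OF hol_poly_base_point[OF assms]])
  have "bounded_linear base_point"
    unfolding linear_conv_bounded_linear[symmetric]
    by (rule linearI) (auto simp: base_point_def vec_eq_iff forall_2)
  from has_derivative_compose[OF bounded_linear_imp_has_derivative[OF this] hol_poly_has_derivative[OF assms]]
  show "((\<lambda>p. f (base_point p)) has_derivative (\<lambda>v. dir_z f (base_point p) (base_point v))) (at p)" .
qed

lemma dir_z_coord_scaled: "dir_z (\<lambda>p. c * p $ k) p v = c * v $ k"
  by (rule dir_z_eqI[OF hol_poly.mult[OF hol_poly.const hol_poly.coord]])
     (intro has_derivative_mult_right bounded_linear_imp_has_derivative bounded_linear_vec_nth)

lemma dir_z_uminus:
  assumes "hol_poly f"
  shows "dir_z (\<lambda>p. - f p) p v = - dir_z f p v"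
  by (rule dir_z_eqI[OF hol_poly_uminus[OF assms]])
     (intro has_derivative_minus hol_poly_has_derivative assms)

lemma
  fixes N :: nat and U :: "nat \<Rightarrow> complex ^ 2 \<Rightarrow> complex" and Q :: "complex ^ 2 \<Rightarrow> real"
  assumes hol: "\<And>j. j \<in> {1..N} \<Longrightarrow> hol_poly (U j)"
    and Q: "\<And>z. complex_of_real (Q z) = (\<Sum>j=1..N. U j z * cnj (U (N - j + 1) z))"
  shows levi_form_defining_function:
      "levi_form (defining_function Q) p v = - Re (chain_pairing N U (base_point p) (base_point v) (base_point v))"
    and dir_z_defining_function:
      "dir_z (defining_function Q) p v = v $ 3 / (2 * \<i>)
         - (\<Sum>j=1..N. dir_z (U j) (base_point p) (base_point v) * cnj (U (N - j + 1) (base_point p)))"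
proof -
  \<comment> \<open>The term \<open>Im w = w / 2\<i> + cnj (w / 2\<i>)\<close> supplies two further products of a holomorphic and an
    antiholomorphic factor, indexed by \<open>0\<close> and \<open>N + 1\<close>. One factor of each is constant, so that they
    do not contribute to the Levi form.\<close>
  define A :: "nat \<Rightarrow> complex ^ 3 \<Rightarrow> complex" where
    "A j = (if j = 0 then (\<lambda>p. 1 / (2 * \<i>) * p $ 3) else if j = Suc N then (\<lambda>p. 1)
            else (\<lambda>p. - U j (base_point p)))" for j
  define B :: "nat \<Rightarrow> complex ^ 3 \<Rightarrow> complex" where
    "B j = (if j = 0 then (\<lambda>p. 1) else if j = Suc N then (\<lambda>p. 1 / (2 * \<i>) * p $ 3)
            else (\<lambda>p. U (N - j + 1) (base_point p)))" for j
  have hol3: "hol_poly (\<lambda>p :: complex ^ 3. 1 / (2 * \<i>) * p $ 3)"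
    by (intro hol_poly.mult hol_poly.const hol_poly.coord)
  have A: "hol_poly (A j)" if "j \<in> {0..Suc N}" for j
    using that hol3 by (auto simp: A_def intro!: hol_poly.const hol_poly_uminus hol_poly_base_point hol)
  have B: "hol_poly (B j)" if "j \<in> {0..Suc N}" for j
    using that hol3 by (auto simp: B_def intro!: hol_poly.const hol_poly_base_point hol)
  have split: "(\<Sum>j=0..Suc N. f j) = f 0 + (\<Sum>j=1..N. f j) + f (Suc N)" for f :: "nat \<Rightarrow> complex"
    by (simp add: sum.atLeast0_atMost_Suc sum.atLeast_Suc_atMost)
  have im: "complex_of_real (Im w) = 1 / (2 * \<i>) * w + cnj (1 / (2 * \<i>) * w)" for w
    by (simp add: complex_eq_iff)
  have r: "defining_function Q = (\<lambda>p. \<Sum>j=0..Suc N. A j p * cnj (B j p))"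
  proof
    fix p
    have "(\<Sum>j=1..N. A j p * cnj (B j p)) = - complex_of_real (Q (base_point p))"
      unfolding Q sum_negf[symmetric] by (rule sum.cong) (auto simp: A_def B_def)
    moreover have "defining_function Q p = complex_of_real (Im (p $ 3)) - complex_of_real (Q (base_point p))"
      by (simp add: defining_function_def base_point_def)
    ultimately show "defining_function Q p = (\<Sum>j=0..Suc N. A j p * cnj (B j p))"
      unfolding split im by (simp add: A_def B_def)
  qed
  have dA: "dir_z (A j) p v = - dir_z (U j) (base_point p) (base_point v)" if "j \<in> {1..N}" for j
    using that by (simp add: A_def dir_z_uminus hol_poly_base_point dir_z_base_point hol)
  have dB: "dir_z (B j) p v = dir_z (U (N - j + 1)) (base_point p) (base_point v)" if "j \<in> {1..N}" for j
    using that dir_z_base_point[OF hol, of "N - j + 1"] by (auto simp add: B_def)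
  show "levi_form (defining_function Q) p v = - Re (chain_pairing N U (base_point p) (base_point v) (base_point v))"
  proof -
    have "(\<Sum>j=0..Suc N. dir_z (A j) p v * cnj (dir_z (B j) p v))
        = (\<Sum>j=1..N. dir_z (A j) p v * cnj (dir_z (B j) p v))"
      unfolding split by (simp add: A_def B_def)
    also have "\<dots> = - chain_pairing N U (base_point p) (base_point v) (base_point v)"
      unfolding chain_pairing_def sum_negf[symmetric] by (intro sum.cong refl) (simp only: dA dB mult_minus_left)
    finally show ?thesis
      by (simp only: r levi_form_sesqui[OF finite_atLeastAtMost A B]) simp
  qed
  show "dir_z (defining_function Q) p v = v $ 3 / (2 * \<i>)
         - (\<Sum>j=1..N. dir_z (U j) (base_point p) (base_point v) * cnj (U (N - j + 1) (base_point p)))"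
  proof -
    have "(\<Sum>j=1..N. dir_z (A j) p v * cnj (B j p))
      = - (\<Sum>j=1..N. dir_z (U j) (base_point p) (base_point v) * cnj (U (N - j + 1) (base_point p)))"
      unfolding sum_negf[symmetric] by (intro sum.cong refl) (auto simp: dA B_def)
    moreover have "dir_z (A 0) p v = v $ 3 / (2 * \<i>)" "dir_z (A (Suc N)) p v = 0" "B 0 p = 1"
      unfolding A_def B_def using dir_z_coord_scaled[of "1 / (2 * \<i>)" 3 p v] by simp_all
    ultimately show ?thesis
      by (simp only: r dir_z_sesqui[OF finite_atLeastAtMost A B]) (simp only: split, simp)
  qed
qed

text \<open>The complex tangent spaces of \<open>M\<^sub>0\<close> are graphs over the \<open>z\<close>-plane and the Levi form does not
  depend on the \<open>w\<close>-component, so every pair \<open>(z, v)\<close> lifts to a point of \<open>M\<^sub>0\<close> and a tangent vector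
  with the same value of the Levi form.\<close>

lemma pseudoconvex_imp_semidefinite:
  fixes U :: "nat \<Rightarrow> complex ^ 2 \<Rightarrow> complex"
  assumes hol: "\<And>j. j \<in> {1..N} \<Longrightarrow> hol_poly (U j)"
    and Q: "\<And>z. complex_of_real (Q z) = (\<Sum>j=1..N. U j z * cnj (U (N - j + 1) z))"
    and "pseudoconvex_model Q"
  obtains \<epsilon> :: real where "\<epsilon> \<noteq> 0" "\<And>z v. 0 \<le> \<epsilon> * Re (chain_pairing N U z v v)"
proof -
  have lift: "\<exists>p\<in>model_hypersurface Q. \<exists>u\<in>holomorphic_tangent (defining_function Q) p.
      levi_form (defining_function Q) p u = - Re (chain_pairing N U z v v)" for z v
  proof -
    define S where "S = (\<Sum>j=1..N. dir_z (U j) z v * cnj (U (N - j + 1) z))"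
    define p :: "complex ^ 3" where "p = vector [z $ 1, z $ 2, \<i> * complex_of_real (Q z)]"
    define u :: "complex ^ 3" where "u = vector [v $ 1, v $ 2, 2 * \<i> * S]"
    have [simp]: "base_point p = z" "base_point u = v" by (simp_all add: p_def u_def)
    have "p \<in> model_hypersurface Q"
      using \<open>base_point p = z\<close> unfolding base_point_def by (simp add: model_hypersurface_def) (simp add: p_def)
    moreover have "dir_z (defining_function Q) p u = 0"
      using dir_z_defining_function[OF hol Q, of p u] by (simp add: S_def) (simp add: u_def S_def)
    then have "u \<in> holomorphic_tangent (defining_function Q) p"
      by (simp add: holomorphic_tangent_def dir_z_def)
    moreover have "levi_form (defining_function Q) p u = - Re (chain_pairing N U z v v)"
      using levi_form_defining_function[OF hol Q, of p u] by simp
    ultimately show ?thesis by blast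
  qed
  consider "\<forall>p\<in>model_hypersurface Q. \<forall>v\<in>holomorphic_tangent (defining_function Q) p. levi_form (defining_function Q) p v \<ge> 0"
    | "\<forall>p\<in>model_hypersurface Q. \<forall>v\<in>holomorphic_tangent (defining_function Q) p. levi_form (defining_function Q) p v \<le> 0"
    using \<open>pseudoconvex_model Q\<close> by (auto simp: pseudoconvex_model_def Let_def)
  then show thesis
  proof cases
    case 1
    have "0 \<le> (-1) * Re (chain_pairing N U z v v)" for z v
      using lift[of z v] 1 by force
    then show thesis using that[of "-1"] by simp
  next
    case 2
    have "0 \<le> 1 * Re (chain_pairing N U z v v)" for z v
      using lift[of z v] 2 by force
    then show thesis using that[of 1] by simp
  qed
qed

lemma has_derivative_poly_field:
  fixes X :: "complex ^ 'm \<Rightarrow> complex ^ 'n"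
  assumes "\<And>i. hol_poly (\<lambda>p. X p $ i)"
  shows "(X has_derivative (\<lambda>v. \<chi> i. dir_z (\<lambda>p. X p $ i) p v)) (at p)"
proof -
  let ?D = "\<lambda>v. \<chi> i. dir_z (\<lambda>p. X p $ i) p v"
  have decomp: "x = (\<Sum>i\<in>UNIV. axis i (x $ i))" for x :: "complex ^ 'n"
    by (simp add: vec_eq_iff axis_def if_distrib cong: if_cong)
  have bl: "bounded_linear (axis i :: complex \<Rightarrow> complex ^ 'n)" for i
    unfolding linear_conv_bounded_linear[symmetric]
    by (rule linearI) (auto simp: vec_eq_iff axis_def)
  have "((\<lambda>p. \<Sum>i\<in>UNIV. axis i (X p $ i)) has_derivative (\<lambda>v. \<Sum>i\<in>UNIV. axis i (?D v $ i))) (at p)"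
    unfolding vec_lambda_beta
    by (intro has_derivative_sum bounded_linear.has_derivative[OF bl] hol_poly_has_derivative assms)
  then show ?thesis
    by (simp only: decomp[symmetric])
qed

text \<open>A field is required to be nonzero arbitrarily close to the origin. The hypotheses on \<open>a\<close> ensure
  this: \<open>X\<close> does not vanish at the points \<open>\<mu>a\<close> with \<open>\<mu> \<noteq> 0\<close>, which tend to the origin.\<close>

lemma annihilating_field_imp_degenerate:
  fixes X :: "complex ^ 2 \<Rightarrow> complex ^ 2" and U :: "nat \<Rightarrow> complex ^ 2 \<Rightarrow> complex"
  assumes hol: "\<And>j. j \<in> {1..N} \<Longrightarrow> hol_poly (U j)"
    and Q: "\<And>z. complex_of_real (Q z) = (\<Sum>j=1..N. U j z * cnj (U (N - j + 1) z))"
    and X: "\<And>i. hol_poly (\<lambda>z. X z $ i)"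
    and X_ne: "X a \<noteq> 0" and scale: "\<And>\<mu>. \<mu> \<noteq> 0 \<Longrightarrow> X (\<mu> *s a) = 0 \<Longrightarrow> X a = 0"
    and zero: "\<And>z. (\<Sum>j=1..N. dir_z (U j) z (X z) * cnj (U (N - j + 1) z)) = 0"
  shows "\<not> holomorphically_nondegenerate Q"
proof -
  define Z :: "complex ^ 3 \<Rightarrow> complex ^ 3" where
    "Z p = vector [X (base_point p) $ 1, X (base_point p) $ 2, 0]" for p
  have Z: "hol_poly (\<lambda>p. Z p $ i)" for i
  proof -
    have "i = 1 \<or> i = 2 \<or> i = 3" using exhaust_3 by blast
    then show ?thesis
      using hol_poly_base_point[OF X] by (auto simp: Z_def intro: hol_poly.const)
  qed
  have "holomorphic_field_on UNIV Z"
    unfolding holomorphic_field_on_def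
    using has_derivative_poly_field[OF Z] by (fastforce simp: vec_eq_iff dir_z_scale)
  moreover have "apply_field Z (defining_function Q) p = 0" for p
    using zero[of "base_point p"] dir_z_defining_function[OF hol Q, of p "Z p"]
    by (simp add: apply_field_eq_dir_z) (simp add: Z_def)
  moreover have "\<exists>\<^sub>F p in nhds 0. Z p \<noteq> 0"
    unfolding frequently_def
  proof
    assume "\<forall>\<^sub>F p in nhds 0. \<not> Z p \<noteq> 0"
    define line :: "complex \<Rightarrow> complex ^ 3" where "line \<mu> = \<mu> *s vector [a $ 1, a $ 2, 0]" for \<mu>
    have "bounded_linear line"
      unfolding linear_conv_bounded_linear[symmetric] line_def
      by (rule linearI) (auto simp: vec_eq_iff algebra_simps)
    then have "(line \<longlongrightarrow> line 0) (at 0)"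
      by (rule bounded_linear.tendsto) (rule tendsto_ident_at)
    then have "filterlim line (nhds 0) (at 0)" by (simp add: line_def)
    then have "\<forall>\<^sub>F \<mu> in at 0. Z (line \<mu>) = 0"
      using \<open>\<forall>\<^sub>F p in nhds 0. \<not> Z p \<noteq> 0\<close> by (auto simp: filterlim_iff)
    then have "\<forall>\<^sub>F \<mu>::complex in at 0. Z (line \<mu>) = 0 \<and> \<mu> \<noteq> 0"
      by (intro eventually_conj eventually_neq_at_within)
    then obtain \<mu> where "Z (line \<mu>) = 0" "\<mu> \<noteq> 0"
      using eventually_happens by fastforce
    have "base_point (line \<mu>) = \<mu> *s a"
      by (simp add: line_def base_point_def vec_eq_iff forall_2)
    with \<open>Z (line \<mu>) = 0\<close> have "X (\<mu> *s a) = 0"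
      by (simp add: Z_def vec_eq_iff forall_2 forall_3)
    with scale \<open>\<mu> \<noteq> 0\<close> X_ne show False by blast
  qed
  ultimately show ?thesis
    unfolding holomorphically_nondegenerate_def by (metis open_UNIV UNIV_I)
qed

text \<open>The Hamiltonian field of \<open>f\<close>, or a coordinate field when \<open>f\<close> is constant.\<close>

lemma exists_field_killing_function:
  fixes f :: "complex ^ 2 \<Rightarrow> complex"
  assumes f: "hol_poly f" and hom: "\<And>\<mu> z. \<mu> \<noteq> 0 \<Longrightarrow> f (\<mu> *s z) = \<mu> ^ d * f z"
  obtains X a where "\<And>i. hol_poly (\<lambda>z. X z $ i)" "\<And>z. dir_z f z (X z) = 0"
    "X a \<noteq> 0" "\<And>\<mu>. \<mu> \<noteq> 0 \<Longrightarrow> X (\<mu> *s a) = 0 \<Longrightarrow> X a = 0"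
proof (cases "\<forall>z k. d_z k f z = 0")
  case True
  show thesis
    by (rule that[of "\<lambda>z. axis 1 1" undefined])
       (use True in \<open>auto intro: hol_poly.const simp: axis_eq_0_iff dir_z_def\<close>)
next
  case False
  then obtain a k where a: "d_z k f a \<noteq> 0" by blast
  define X :: "complex ^ 2 \<Rightarrow> complex ^ 2" where "X z = vector [d_z 2 f z, - d_z 1 f z]" for z
  have X0: "X z = 0 \<longleftrightarrow> (\<forall>k. d_z k f z = 0)" for z
    by (auto simp: X_def vec_eq_iff forall_2)
  show thesis
  proof (rule that[of X a])
    fix i :: 2
    have "i = 1 \<or> i = 2" using exhaust_2 by blast
    then show "hol_poly (\<lambda>z. X z $ i)"
      using hol_poly_d_z[OF f] hol_poly_uminus[OF hol_poly_d_z[OF f]] by (auto simp: X_def)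
  next
    show "dir_z f z (X z) = 0" for z
      by (simp add: dir_z_def X_def sum_2)
  next
    show "X a \<noteq> 0" using a X0 by blast
  next
    fix \<mu> :: complex assume "\<mu> \<noteq> 0" "X (\<mu> *s a) = 0"
    have "\<mu> * d_z k f (\<mu> *s a) = \<mu> ^ d * d_z k f a" for k
      using dir_z_homogeneous[OF f hom[OF \<open>\<mu> \<noteq> 0\<close>], of a "axis k 1"] by simp
    then show "X a = 0" using \<open>\<mu> \<noteq> 0\<close> \<open>X (\<mu> *s a) = 0\<close> X0 by (metis mult_eq_0_iff power_eq_0_iff)
  qed
qed

theorem theorem1p17:
  fixes Q :: "complex ^ 2 \<Rightarrow> real"
    and Y :: "complex ^ 2 \<Rightarrow> complex ^ 2"
    and U :: "nat \<Rightarrow> complex ^ 2 \<Rightarrow> complex"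
    and m N \<tau> :: nat
  assumes "model_polynomial m Q"
    and "\<tau> \<in> {1..m - 2}"
    and "Y \<in> g_component Q \<tau>"
    and "\<exists>z. Y z \<noteq> 0"
    and "symmetric_chain Y N U"
    and "\<And>z. complex_of_real (Q z) = (\<Sum>j=1..N. U j z * cnj (U (N - j + 1) z))"
    and "holomorphically_nondegenerate Q"
  shows "\<not> pseudoconvex_model Q"
proof
  assume pc: "pseudoconvex_model Q"
  note Q = assms(6)
  have "1 \<le> N" using assms(5) by (simp add: symmetric_chain_def)
  then have "1 \<in> {1..N}" by simp
  then obtain d where d: "hom_hol_poly d (U 1)"
    using assms(5) unfolding symmetric_chain_def by blast
  have Y: "\<And>j. hom_hol_poly (\<tau> + 1) (\<lambda>z. Y z $ j)"
    using assms(3) by (simp add: g_component_def)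
  interpret graded_chain N d \<tau> U
    using symmetric_chain_graded[OF assms(5) Y d] assms(2) by simp
  obtain \<epsilon> :: real where \<epsilon>: "\<epsilon> \<noteq> 0" "\<And>z v. 0 \<le> \<epsilon> * Re (chain_pairing N U z v v)"
    using pseudoconvex_imp_semidefinite[OF hol_poly_U Q pc] by blast
  \<comment> \<open>For even \<open>N\<close> there is no middle member and any nonzero field will do; taking \<open>h = 0\<close> covers
    this case.\<close>
  define h where "h = (if odd N then U ((N + 1) div 2) else (\<lambda>z. 0))"
  have mid: "(N + 1) div 2 \<in> {1..N}" using \<open>1 \<le> N\<close> by auto
  have h: "hol_poly h" using hol_poly_U[OF mid] by (auto simp: h_def intro: hol_poly.const)
  have h_hom: "h (\<mu> *s z) = \<mu> ^ (d + ((N + 1) div 2 - 1) * \<tau>) * h z" if "\<mu> \<noteq> 0" for \<mu> z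
    unfolding h_def using homogeneous_U[OF mid that]
    by (cases "odd N") (simp_all only: if_True if_False mult_zero_right not_False_eq_True not_True_eq_False)
  obtain X a where X: "\<And>i. hol_poly (\<lambda>z. X z $ i)" "\<And>z. dir_z h z (X z) = 0"
    "X a \<noteq> 0" "\<And>\<mu>. \<mu> \<noteq> 0 \<Longrightarrow> X (\<mu> *s a) = 0 \<Longrightarrow> X a = 0"
  proof (rule exists_field_killing_function[OF h h_hom])
    fix X a
    assume "\<And>i. hol_poly (\<lambda>z. X z $ i)" "\<And>z. dir_z h z (X z) = 0"
      "X a \<noteq> 0" "\<And>\<mu>. \<mu> \<noteq> 0 \<Longrightarrow> X (\<mu> *s a) = 0 \<Longrightarrow> X a = 0"
    then show thesis by (rule that)
  qed
  have kills: "kills_middle z (X z)" for z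
    unfolding kills_middle_def
  proof (intro ballI impI)
    fix j assume "j \<in> {1..N}" "N - j + 1 = j"
    then have "N = 2 * j - 1" "1 \<le> j" by auto
    then have "h = U j" by (auto simp: h_def)
    then show "dir_z (U j) z (X z) = 0" using X(2) by simp
  qed
  have "dir_z (U N) z (X z) = 0" if "d = 0" for z
  proof (cases "N = 1")
    case True
    then show ?thesis using kills[of z] unfolding kills_middle_def by simp
  next
    case False
    then show ?thesis
      using symmetric_chain_constant_start[OF assms(5)] d that \<open>1 \<le> N\<close> by simp
  qed
  then have "(\<Sum>j=1..N. dir_z (U j) z (X z) * cnj (U (N - j + 1) z)) = 0" for z
    by (intro semidefinite_imp_annihilates[OF \<epsilon>(2,1) kills])
  then show False
    using annihilating_field_imp_degenerate[OF hol_poly_U Q X(1,3) X(4)] assms(7) by simp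
qed

end
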